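(* Let $a,b$ be complex numbers with $|a|<1$ and $|b|<1$, and let $A_0,B_0,C_0$ be arbitrary complex numbers. Define polynomials in $n$ \begin{align*} p(n)&=30n^7+105n^6+n^5(145-52(a^2+b^2))+n^4(100-130(a^2+b^2))\\ &\quad+n^3(35-124(a^2+b^2)+56(a^4+b^4)-208a^2b^2)+n^2(5-56(a^2+b^2)+84(a^4+b^4)-312a^2b^2)\\ &\quad+n\big(80a^2b^2(a^2+b^2)-16(a^6+b^6)+48(a^4+b^4-3a^2b^2)-14(a^2+b^2)\big)\\ &\quad+\big(10(a^2-b^2)^2-2(a^2+b^2)+40a^2b^2(a^2+b^2)-8(a^6+b^6)\big),\\ q(n)&=n^8-6n^6(a^2+b^2)+n^4(9(a^4+b^4)+30a^2b^2)-n^2(28a^2b^2(a^2+b^2)+4(a^6+b^6))+16a^2b^2(a^2-b^2)^2. \end{align*} Let $(L_n)_{n\ge 0}$ be the sequence defined by $L_0=C_0$, $$L_1=\left(\frac{1}{3}-\frac{2}{15}(a^2+b^2)\right)A_0+\left(\frac{1}{6}(a^2+b^2)-\frac{2}{15}(a^4+b^4-4a^2b^2)-\frac{1}{30}\right)C_0,$$ and, for $n=1,2,\ldots$, $$4(4n+3)(4n+5)(5n^2-2a^2-2b^2)L_{n+1}+2(n+1)p(n)L_n-n(n+1)(5(n+1)^2-2a^2-2b^2)q(n)L_{n-1}=0.$$ For $n\ge 1$ put \begin{align*} d_n&=\frac{(-1)^{n-1}B_0(n-1)!(5n^2-a^2-b^2)}{2^{n+1}}\prod_{m=1}^{n-1}\left(\frac{(m^2-(a^2+b^2))^2-4a^2b^2}{2m+1}\right)\\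 &\quad+\frac{20n+5}{2(5n^2-2a^2-2b^2)}L_n+\frac{35n^5-35n^3(a^2+b^2)+4n(3a^4+3b^4-4a^2b^2)}{4(5n^2-2a^2-2b^2)}L_{n-1} \end{align*} (an empty product equals $1$). Then $$\sum_{k=1}^{\infty}\frac{A_0+B_0k+C_0k^2}{(k^2-a^2)(k^2-b^2)}=\sum_{n=1}^{\infty}\frac{d_n}{\prod_{m=1}^n(m^2-a^2)(m^2-b^2)}.$$ *)

theory Defs
  imports Complex_Main
begin

definition p_poly :: "complex \<Rightarrow> complex \<Rightarrow> complex \<Rightarrow> complex" where
  "p_poly a b n =
     30 * n^7 + 105 * n^6
     + n^5 * (145 - 52 * (a^2 + b^2))
     + n^4 * (100 - 130 * (a^2 + b^2))
     + n^3 * (35 - 124 * (a^2 + b^2) + 56 * (a^4 + b^4) - 208 * a^2 * b^2)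
     + n^2 * (5 - 56 * (a^2 + b^2) + 84 * (a^4 + b^4) - 312 * a^2 * b^2)
     + n * (80 * a^2 * b^2 * (a^2 + b^2) - 16 * (a^6 + b^6)
            + 48 * (a^4 + b^4 - 3 * a^2 * b^2) - 14 * (a^2 + b^2))
     + (10 * (a^2 - b^2)^2 - 2 * (a^2 + b^2) + 40 * a^2 * b^2 * (a^2 + b^2) - 8 * (a^6 + b^6))"

definition q_poly :: "complex \<Rightarrow> complex \<Rightarrow> complex \<Rightarrow> complex" where
  "q_poly a b n =
     n^8 - 6 * n^6 * (a^2 + b^2)
     + n^4 * (9 * (a^4 + b^4) + 30 * a^2 * b^2)
     - n^2 * (28 * a^2 * b^2 * (a^2 + b^2) + 4 * (a^6 + b^6))
     + 16 * a^2 * b^2 * (a^2 - b^2)^2"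

text \<open>Only used for \<open>n \<ge> 1\<close>, so the truncated subtractions \<open>n - 1\<close> on \<open>nat\<close> are exact.\<close>

definition d_coeff ::
  "complex \<Rightarrow> complex \<Rightarrow> complex \<Rightarrow> (nat \<Rightarrow> complex) \<Rightarrow> nat \<Rightarrow> complex" where
  "d_coeff a b B0 L n =
     (-1)^(n - 1) * B0 * fact (n - 1) * (5 * of_nat n^2 - a^2 - b^2) / 2^(n + 1)
       * (\<Prod>m = 1..n - 1. ((of_nat m^2 - (a^2 + b^2))^2 - 4 * a^2 * b^2) / (2 * of_nat m + 1))
     + (20 * of_nat n + 5) / (2 * (5 * of_nat n^2 - 2 * a^2 - 2 * b^2)) * L n
     + (35 * of_nat n^5 - 35 * of_nat n^3 * (a^2 + b^2)
          + 4 * of_nat n * (3 * a^4 + 3 * b^4 - 4 * a^2 * b^2))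
       / (4 * (5 * of_nat n^2 - 2 * a^2 - 2 * b^2)) * L (n - 1)"

end

(* Put W(x) = (x^2 - a^2)(x^2 - b^2). The proof is Markov's acceleration: in
     F(n,k) = (A_n + B_n z + C_n z^2) / (W(k) W(k+1) ... W(k+n)),   z = k + n/2,
   the numerator of F(0,k) is A0 + B0 k + C0 k^2, and for every quadratic numerator there are a
   unique next quadratic numerator and a cubic V_n such that
     F(n,k) - F(n+1,k) = G(n,k) - G(n,k+1),   G(n,k) = V_n(z) / (W(k) ... W(k+n)).
   Centring at z makes the linear system for them split into an even part (A_n, C_n) and an odd part
   (B_n). Its solution is C_n = (4n+1) L_n in the even part and a closed product in the odd part, and
   V_n(1 + n/2) = d_{n+1}. Summing over k and n gives the identity once sum_k F(n,k) tends to 0.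
   After division by W(1) ... W(n) the recurrence of L has limiting coefficients -3/16 and 1/64, so
   the quotient is O(2^-n), and similarly for the odd part. *)
theory Submission
  imports Defs "HOL-Real_Asymp.Real_Asymp" "HOL-Computational_Algebra.Polynomial"
begin

subsection \<open>Polynomial identities\<close>

text \<open>In the step \<open>n - 1 \<rightarrow> n\<close> write \<open>V(z) = s z + t z^3 + (A + C z^2)/2\<close> for the even part.
  Comparing coefficients gives \<open>C = (4n - 3) t\<close> and then \<open>A\<close> and the next \<open>C\<close> as linear forms in \<open>s\<close> and \<open>t\<close>;
  the two polynomials below, at \<open>x = n\<close>, are (up to sign and a factor \<open>n\<close>) their coefficients of \<open>t\<close>.\<close>

definition even_defect :: "complex \<Rightarrow> complex \<Rightarrow> complex \<Rightarrow> complex" where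
  "even_defect a b x = - 29 * x^4 / 4 + 10 * x^3 - 15 * x^2 / 4
     + (a^2 + b^2) * (7 * x^2 - 4 * x + 3/2) - 2 * (a^2 + b^2)^2 + 4 * a^2 * b^2"

definition even_shift :: "complex \<Rightarrow> complex \<Rightarrow> complex \<Rightarrow> complex" where
  "even_shift a b x = 5 * x^3 - 8 * x^2 + 4 * x - 1/2 - 2 * (a^2 + b^2) * x"

definition quartic :: "complex \<Rightarrow> complex \<Rightarrow> complex \<Rightarrow> complex" where
  "quartic a b x = (x^2 - a^2) * (x^2 - b^2)"

text \<open>In \<open>even_step\<close> the map (s, t) -> (A', C') has determinant x^2 W(x/2) (4R -
  D h), where R = \<open>even_defect a b x\<close>, D = 5x^2 - 2a^2 - 2b^2 and h = 2(a^2 + b^2) -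
  5x^2 + 8x - 3. Thus q is this determinant times -4/x^2.\<close>

lemma q_poly_factor:
  "q_poly a b x = 4 * quartic a b (x / 2)
     * ((5 * x^2 - 2 * a^2 - 2 * b^2) * (2 * (a^2 + b^2) - 5 * x^2 + 8 * x - 3)
        - 4 * even_defect a b x)"
  unfolding q_poly_def quartic_def even_defect_def by (simp add: field_simps, algebra)

text \<open>Eliminating the slopes at x and x + 1 leaves three contributions to the coefficient of
  the middle term of the recurrence: from the later slope, from the even shift at x + 1, and from
  the earlier slope. They appear in this order and add up to -p.\<close>

lemma p_poly_decomp:
  "- p_poly a b x = 2 * (5 * x^2 - 2 * a^2 - 2 * b^2) * (4 * x + 3) * even_defect a b (x + 1)
     + 2 * (5 * x^2 - 2 * a^2 - 2 * b^2) * (5 * (x + 1)^2 - 2 * a^2 - 2 * b^2)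
         * even_shift a b (x + 1)
     + 8 * (5 * (x + 1)^2 - 2 * a^2 - 2 * b^2) * quartic a b (x / 2) * (4 * x + 1)"
  unfolding p_poly_def quartic_def even_defect_def even_shift_def by (simp add: field_simps, algebra)

text \<open>The even half of the step with denominators cleared; y is the new centre and y + 1/2, y
  - 1/2 are the old ones. Since W is even, y -> -y exchanges the two products up to sign, so only
  even powers of y survive. \<open>C\<close> and \<open>A\<close> are what makes the coefficients of
  y^6 and y^4 vanish.\<close>

lemma even_step:
  fixes a b x y s t :: complex
  defines "\<sigma> \<equiv> a^2 + b^2"
  defines "A \<equiv> (4 * x - 1) * s - even_shift a b x * t"
    and "C \<equiv> (4 * x - 3) * t"
    and "A' \<equiv> x * quartic a b (x / 2) * (4 * s + (2 * \<sigma> - 5 * x^2 + 8 * x - 3) * t)"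
    and "C' \<equiv> x * (5 * x^2 - 2 * \<sigma>) * s + x * even_defect a b x * t"
  shows "A' + C' * y^2 =
     (s * (y + 1/2) + t * (y + 1/2)^3 + (A + C * (y + 1/2)^2) / 2) * quartic a b (y - x / 2)
   - (s * (y - 1/2) + t * (y - 1/2)^3 - (A + C * (y - 1/2)^2) / 2) * quartic a b (y + x / 2)"
  unfolding assms quartic_def even_defect_def even_shift_def
  by (simp add: field_simps, algebra)

text \<open>The same symmetry with parities exchanged: the right side is odd in y. Vanishing of the
  coefficients of y^5 and y^3 gives \<open>B\<close> and \<open>r\<close>; a single unknown
  \<open>t\<close> is left, so the odd part obeys a first-order recurrence.\<close>

lemma odd_step:
  fixes a b x y t :: complex
  defines "\<sigma> \<equiv> a^2 + b^2"
  defines "B \<equiv> (4 * x - 2) * t"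
    and "B' \<equiv> - x * ((x^2 - \<sigma>)^2 - 4 * a^2 * b^2) * t"
    and "r \<equiv> (5 * x^2 / 2 - \<sigma> - 2 * x + 1/2) / 2 * t"
  shows "B' * y =
     (r + t * (y + 1/2)^2 + B * (y + 1/2) / 2) * quartic a b (y - x / 2)
   - (r + t * (y - 1/2)^2 - B * (y - 1/2) / 2) * quartic a b (y + x / 2)"
  unfolding assms quartic_def
  by (simp add: field_simps, algebra)


text \<open>The next A has two expressions: one through the next slope \<open>s'\<close>, the other
  as the image A' of the current step. Their agreement is what the three-term recurrence says once
  both slopes are eliminated, with \<open>l0\<close>, \<open>l1\<close>, \<open>l2\<close> as
  consecutive values of \<open>L\<close>.\<close>

lemma even_recurrence:
  fixes a b x s s' l0 l1 l2 :: complex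
  defines "\<sigma> \<equiv> a^2 + b^2"
  assumes nz: "x + 1 \<noteq> 0" "5 * x^2 - 2 * a^2 - 2 * b^2 \<noteq> 0" "5 * (x + 1)^2 - 2 * a^2 - 2 * b^2 \<noteq> 0"
    and s: "x * (5 * x^2 - 2 * a^2 - 2 * b^2) * s = (4 * x + 1) * l1 - x * even_defect a b x * l0"
    and s': "(x + 1) * (5 * (x + 1)^2 - 2 * a^2 - 2 * b^2) * s'
       = (4 * x + 5) * l2 - (x + 1) * even_defect a b (x + 1) * l1"
    and rec: "4 * (4 * x + 3) * (4 * x + 5) * (5 * x^2 - 2 * a^2 - 2 * b^2) * l2
      + 2 * (x + 1) * p_poly a b x * l1
      - x * (x + 1) * (5 * (x + 1)^2 - 2 * a^2 - 2 * b^2) * q_poly a b x * l0 = 0"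
  shows "(4 * x + 3) * s' - even_shift a b (x + 1) * l1
     = x * quartic a b (x / 2) * (4 * s + (2 * \<sigma> - 5 * x^2 + 8 * x - 3) * l0)"
proof -
  define D D' where "D = 5 * x^2 - 2 * a^2 - 2 * b^2" and "D' = 5 * (x + 1)^2 - 2 * a^2 - 2 * b^2"
  define R R' Y w h where "R = even_defect a b x" and "R' = even_defect a b (x + 1)"
    and "Y = even_shift a b (x + 1)" and "w = quartic a b (x / 2)"
    and "h = 2 * \<sigma> - 5 * x^2 + 8 * x - 3"
  have q: "q_poly a b x = 4 * w * (D * h - 4 * R)"
    using q_poly_factor[of a b x] by (simp add: w_def D_def h_def R_def \<sigma>_def)
  have p: "p_poly a b x = - (2 * D * (4 * x + 3) * R' + 2 * D * D' * Y + 8 * D' * w * (4 * x + 1))"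
    using p_poly_decomp[of a b x] unfolding D_def D'_def R'_def Y_def w_def
    by (metis add.inverse_inverse)
  note s = s[folded D_def R_def] and s' = s'[folded D'_def R'_def]
    and rec = rec[folded D_def D'_def, unfolded q p]
  \<comment> \<open>With this factor \<open>s'\<close> can be traded for \<open>l2\<close>,
    \<open>rec\<close> removes \<open>l2\<close>, and the terms left in \<open>l1\<close> and
    \<open>l0\<close> reassemble into \<open>s\<close>.\<close>
  have "4 * (x + 1) * D * D' * ((4 * x + 3) * s' - Y * l1)
      = 4 * (4 * x + 3) * D * ((x + 1) * D' * s') - 4 * (x + 1) * D * D' * Y * l1"
    by (simp add: algebra_simps)
  also have "\<dots> = 16 * (x + 1) * D' * w * ((4 * x + 1) * l1 - x * R * l0) + 4 * (x + 1) * D' * x * D * w * h * l0"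
    unfolding s' using rec by algebra
  also have "\<dots> = 4 * (x + 1) * D * D' * (x * w * (4 * s + h * l0))"
    unfolding s[symmetric] by (simp add: algebra_simps)
  finally have "4 * (x + 1) * D * D' * ((4 * x + 3) * s' - Y * l1)
      = 4 * (x + 1) * D * D' * (x * w * (4 * s + h * l0))" .
  moreover have "4 * (x + 1) * D * D' \<noteq> 0"
    using nz by (simp only: D_def D'_def mult_eq_0_iff) simp
  ultimately have "(4 * x + 3) * s' - Y * l1 = x * w * (4 * s + h * l0)"
    by (metis mult_left_cancel)
  then show ?thesis unfolding Y_def w_def h_def .
qed

text \<open>z = (x + 1)/2 is the centre belonging to the first k. There the coefficient of
  \<open>s\<close> is z + (4x - 1)/2 = 5x/2, so the slope enters only through x * s.\<close>

lemma even_boundary: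
  fixes a b x s l0 l1 :: complex
  defines "z \<equiv> (x + 1) / 2"
  defines "A \<equiv> (4 * x - 1) * s - even_shift a b x * l0"
    and "C \<equiv> (4 * x - 3) * l0"
  assumes nz: "5 * x^2 - 2 * a^2 - 2 * b^2 \<noteq> 0"
    and s: "x * (5 * x^2 - 2 * a^2 - 2 * b^2) * s = (4 * x + 1) * l1 - x * even_defect a b x * l0"
  shows "s * z + l0 * z^3 + (A + C * z^2) / 2
    = (20 * x + 5) / (2 * (5 * x^2 - 2 * a^2 - 2 * b^2)) * l1
     + (35 * x^5 - 35 * x^3 * (a^2 + b^2) + 4 * x * (3 * a^4 + 3 * b^4 - 4 * a^2 * b^2))
       / (4 * (5 * x^2 - 2 * a^2 - 2 * b^2)) * l0"
proof -
  define D where "D = 5 * x^2 - 2 * a^2 - 2 * b^2"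
  define c where "c = z^3 + ((4 * x - 3) * z^2 - even_shift a b x) / 2"
  have xs: "x * s = ((4 * x + 1) * l1 - x * even_defect a b x * l0) / D"
    using s nz by (simp add: D_def field_simps)
  have c: "4 * D * c - 10 * x * even_defect a b x = 35 * x^5 - 35 * x^3 * (a^2 + b^2) + 4 * x * (3 * a^4 + 3 * b^4 - 4 * a^2 * b^2)"
    unfolding c_def D_def z_def even_shift_def even_defect_def by (simp add: field_simps, algebra)
  have "s * z + l0 * z^3 + (A + C * z^2) / 2 = 5 / 2 * (x * s) + c * l0"
    unfolding A_def C_def c_def z_def by (simp add: field_simps)
  also have "\<dots> = (20 * x + 5) / (2 * D) * l1 + (4 * D * c - 10 * x * even_defect a b x) / (4 * D) * l0"
    unfolding xs using nz[folded D_def] by (simp add: field_simps)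
  finally show ?thesis unfolding c unfolding D_def .
qed

lemma odd_boundary:
  fixes a b x t :: complex
  defines "z \<equiv> (x + 1) / 2"
  shows "(5 * x^2 / 2 - (a^2 + b^2) - 2 * x + 1/2) / 2 * t + t * z^2 + (4 * x - 2) * t * z / 2
    = (5 * x^2 - a^2 - b^2) / 2 * t"
  unfolding z_def by (simp add: field_simps power2_eq_square)

subsection \<open>Recurrences, telescoping and limits at infinity\<close>

text \<open>A bound K/2^n passes through the recurrence once |c n|/2 + |e n| <= 1/4, the right side
  being the square of the ratio 1/2. A geometric bound then beats every power of n.\<close>

lemma linear_recurrence_decay:
  fixes r c e :: "nat \<Rightarrow> complex"
  assumes rec: "\<And>n. r (Suc (Suc n)) = c n * r (Suc n) + e n * r n"
    and c: "c \<longlonglongrightarrow> c0" and e: "e \<longlonglongrightarrow> e0"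
    and small: "norm c0 / 2 + norm e0 < 1 / 4"
  shows "(\<lambda>n. of_nat (Suc n) ^ j * r n) \<longlonglongrightarrow> 0"
proof -
  have "(\<lambda>n. norm (c n) / 2 + norm (e n)) \<longlonglongrightarrow> norm c0 / 2 + norm e0"
    by (intro tendsto_intros c e) auto
  from order_tendstoD(2)[OF this small] obtain N
    where N: "\<And>n. n \<ge> N \<Longrightarrow> norm (c n) / 2 + norm (e n) \<le> 1 / 4"
    by (auto simp: eventually_sequentially intro: less_imp_le)
  \<comment> \<open>The range ends at N + 1 because the first inductive case n = N + 2 refers back
    to N + 1 and N.\<close>
  define K where "K = (\<Sum>n\<le>Suc N. norm (r n) * 2 ^ n)"
  have K0: "K \<ge> 0" unfolding K_def by (intro sum_nonneg) auto
  have bound: "norm (r n) \<le> K / 2 ^ n" for n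
  proof (induction n rule: less_induct)
    case (less n)
    show ?case
    proof (cases "n \<le> Suc N")
      case True
      then have "norm (r n) * 2 ^ n \<le> K"
        unfolding K_def by (intro member_le_sum) auto
      then show ?thesis by (simp add: field_simps)
    next
      case False
      then obtain m where m: "n = Suc (Suc m)" "m \<ge> N"
        by (metis Suc_le_D Suc_le_mono not_less_eq_eq)
      have "norm (r n) \<le> norm (c m) * norm (r (Suc m)) + norm (e m) * norm (r m)"
        unfolding m(1) rec by (metis norm_mult norm_triangle_ineq)
      also have "\<dots> \<le> norm (c m) * (K / 2 ^ Suc m) + norm (e m) * (K / 2 ^ m)"
        using less.IH[of "Suc m"] less.IH[of m] m(1) by (intro add_mono mult_left_mono) auto
      also have "\<dots> = (norm (c m) / 2 + norm (e m)) * (K / 2 ^ m)"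
        by (simp add: field_simps)
      also have "\<dots> \<le> 1 / 4 * (K / 2 ^ m)"
        using N[OF m(2)] K0 by (intro mult_right_mono) auto
      also have "\<dots> = K / 2 ^ n" unfolding m(1) by simp
      finally show ?thesis .
    qed
  qed
  have "(\<lambda>n. real (Suc n) ^ j / 2 ^ n) \<longlonglongrightarrow> 0"
    by real_asymp
  then show ?thesis
  proof (rule tendsto_0_le)
    have "norm (of_nat (Suc n) ^ j * r n) \<le> norm (real (Suc n) ^ j / 2 ^ n) * K" for n
      using mult_left_mono[OF bound[of n], of "real (Suc n) ^ j"]
      by (simp add: norm_mult norm_power norm_divide mult_ac del: of_nat_Suc)
    then show "\<forall>\<^sub>F n in sequentially. norm (of_nat (Suc n) ^ j * r n) \<le> norm (real (Suc n) ^ j / 2 ^ n) * K"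
      by simp
  qed
qed

text \<open>Summing \<open>step\<close> over k leaves G n 0 as the difference of consecutive row
  sums of F; these differences telescope in turn because the row sums tend to 0. No double series is
  rearranged.\<close>

lemma sums_telescoping_pair:
  fixes F G :: "nat \<Rightarrow> nat \<Rightarrow> complex"
  assumes F: "\<And>n. summable (F n)"
    and step: "\<And>n k. F n k - F (Suc n) k = G n k - G n (Suc k)"
    and G: "\<And>n. G n \<longlonglongrightarrow> 0"
    and lim: "(\<lambda>n. suminf (F n)) \<longlonglongrightarrow> 0"
  shows "(\<lambda>n. G n 0) sums suminf (F 0)"
proof -
  have "suminf (F n) - suminf (F (Suc n)) = G n 0" for n
  proof -
    have "(\<lambda>k. F n k - F (Suc n) k) sums (G n 0 - 0)"
      unfolding step by (rule telescope_sums'[OF G])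
    moreover have "(\<lambda>k. F n k - F (Suc n) k) sums (suminf (F n) - suminf (F (Suc n)))"
      by (intro sums_diff summable_sums F)
    ultimately show ?thesis using sums_unique2 by fastforce
  qed
  then show ?thesis using telescope_sums'[OF lim] by simp
qed

section \<open>Limits at infinity of polynomials and of the recurrence coefficients\<close>

lemma poly_at_infinity:
  fixes f :: "complex \<Rightarrow> complex"
  assumes "\<And>x. f x = poly q x" and "degree q = d" and "lead_coeff q = l"
  shows "((\<lambda>x. f x / x ^ d) \<longlongrightarrow> l) at_infinity"
  using poly_divide_tendsto_aux[of q] assms by simp

lemma p_poly_at_infinity: "((\<lambda>x. p_poly a b x / x^7) \<longlongrightarrow> 30) at_infinity"
  by (rule poly_at_infinity[where q =
    "[:10 * (a^2 - b^2)^2 - 2 * (a^2 + b^2) + 40 * a^2 * b^2 * (a^2 + b^2) - 8 * (a^6 + b^6),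
    80 * a^2 * b^2 * (a^2 + b^2) - 16 * (a^6 + b^6) + 48 * (a^4 + b^4 - 3 * a^2 * b^2) - 14 * (a^2 + b^2),
    5 - 56 * (a^2 + b^2) + 84 * (a^4 + b^4) - 312 * a^2 * b^2,
    35 - 124 * (a^2 + b^2) + 56 * (a^4 + b^4) - 208 * a^2 * b^2,
    100 - 130 * (a^2 + b^2), 145 - 52 * (a^2 + b^2), 105, 30:]"])
    ((unfold p_poly_def poly_pCons poly_0, algebra), simp_all)

lemma q_poly_at_infinity: "((\<lambda>x. q_poly a b x / x^8) \<longlongrightarrow> 1) at_infinity"
  by (rule poly_at_infinity[where q =
    "[:16 * a^2 * b^2 * (a^2 - b^2)^2, 0, - (28 * a^2 * b^2 * (a^2 + b^2) + 4 * (a^6 + b^6)), 0,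
       9 * (a^4 + b^4) + 30 * a^2 * b^2, 0, - 6 * (a^2 + b^2), 0, 1:]"])
    ((unfold q_poly_def poly_pCons poly_0, algebra), simp_all)

lemma quartic_at_infinity: "((\<lambda>x. quartic a b x / x^4) \<longlongrightarrow> 1) at_infinity"
  by (rule poly_at_infinity[where q = "[:a^2 * b^2, 0, - (a^2 + b^2), 0, 1:]"])
    ((unfold quartic_def poly_pCons poly_0, algebra), simp_all)

lemma quartic_shift_at_infinity: "((\<lambda>x. quartic a b (x + 1) / x^4) \<longlongrightarrow> 1) at_infinity"
  by (rule poly_at_infinity[where q =
    "[:(1 - a^2) * (1 - b^2), 4 - 2 * (a^2 + b^2), 6 - (a^2 + b^2), 4, 1:]"])
    ((unfold quartic_def poly_pCons poly_0, algebra), simp_all)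

lemma even_defect_at_infinity: "((\<lambda>x. even_defect a b x / x^4) \<longlongrightarrow> - 29 / 4) at_infinity"
  by (rule poly_at_infinity[where q =
    "[:(a^2 + b^2) * 3/2 - 2 * (a^2 + b^2)^2 + 4 * a^2 * b^2, - 4 * (a^2 + b^2), - 15/4 + 7 * (a^2 + b^2), 10, - 29/4:]"])
    ((simp add: even_defect_def field_simps, algebra), simp_all)

lemma even_shift_at_infinity: "((\<lambda>x. even_shift a b x / x^3) \<longlongrightarrow> 5) at_infinity"
  by (rule poly_at_infinity[where q = "[:- 1/2, 4 - 2 * (a^2 + b^2), - 8, 5:]"])
    ((simp add: even_shift_def field_simps, algebra), simp_all)

lemma linear_at_infinity:
  fixes c d :: complex
  assumes "c \<noteq> 0"
  shows "((\<lambda>x. (c * x + d) / x) \<longlongrightarrow> c) at_infinity"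
  using poly_divide_tendsto_aux[of "[:d, c:]"] assms by (simp add: algebra_simps)

lemma quadratic_at_infinity:
  fixes a b :: complex
  shows "((\<lambda>x. (5 * x^2 - 2 * a^2 - 2 * b^2) / x^2) \<longlongrightarrow> 5) at_infinity"
  by (rule poly_at_infinity[where q = "[:- 2 * a^2 - 2 * b^2, 0, 5:]"])
    ((unfold poly_pCons poly_0, algebra), simp_all)

lemma quadratic_shift_at_infinity:
  fixes a b :: complex
  shows "((\<lambda>x. (5 * (x + 1)^2 - 2 * a^2 - 2 * b^2) / x^2) \<longlongrightarrow> 5) at_infinity"
  by (rule poly_at_infinity[where q = "[:5 - 2 * a^2 - 2 * b^2, 10, 5:]"])
    ((unfold poly_pCons poly_0, algebra), simp_all)

lemma odd_factor_at_infinity: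
  fixes a b :: complex
  shows "((\<lambda>x. ((x^2 - (a^2 + b^2))^2 - 4 * a^2 * b^2) / x^4) \<longlongrightarrow> 1) at_infinity"
  by (rule poly_at_infinity[where q = "[:(a^2 - b^2)^2, 0, - 2 * (a^2 + b^2), 0, 1:]"])
    ((unfold poly_pCons poly_0, algebra), simp_all)

lemma tendsto_at_infinity_cong:
  fixes f g :: "complex \<Rightarrow> complex"
  assumes "(f \<longlongrightarrow> l) at_infinity" and "l = l'" and "\<And>x. x \<noteq> 0 \<Longrightarrow> f x = g x"
  shows "(g \<longlongrightarrow> l') at_infinity"
proof (rule Lim_transform_eventually)
  show "(f \<longlongrightarrow> l') at_infinity" using assms(1,2) by simp
  show "\<forall>\<^sub>F x in at_infinity. f x = g x"
    using eventually_not_equal_at_infinity[of 0] by eventually_elim (rule assms(3))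
qed

text \<open>Numerator and denominator are both divided by x^8. If one of c, d, e, f vanishes, both
  sides are 0.\<close>

lemma first_coefficient_cancel:
  fixes x :: complex
  assumes "x \<noteq> 0"
  shows "- (2 * (X / x) * (p / x^7)) / (4 * (c / x) * (d / x) * (e / x^2) * (f / x^4)) = - (2 * X * p) / (4 * c * d * e * f)"
proof -
  have "x * x * x^2 * x^4 = x^8" "x * x^7 = x^8" by (simp_all add: eval_nat_numeral)
  then have e1: "4 * (c / x) * (d / x) * (e / x^2) * (f / x^4) = 4 * c * d * e * f / x^8" and e2: "- (2 * (X / x) * (p / x^7)) = - (2 * X * p) / x^8"
    by (simp_all only: times_divide_eq_left times_divide_eq_right divide_divide_eq_left mult_ac minus_divide_left)
  show ?thesis unfolding e1 e2 using assms by simp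
qed
text \<open>The denominator is divided by x^12 but the numerator only by x^11; the difference is the
  extra factor x on the right.\<close>

lemma second_coefficient_cancel:
  fixes x :: complex
  assumes "x \<noteq> 0"
  shows "(X / x) * (Y / x^2) * (q / x^8) / (4 * (c / x) * (d / x) * (e / x^2) * ((f / x^4) * (g / x^4))) = x * X * Y * q / (4 * c * d * e * (f * g))"
proof -
  have "x * x * x^2 * x^4 * x^4 = x^12" "x * x^2 * x^8 = x^11" by (simp_all add: eval_nat_numeral)
  then have e1: "4 * (c / x) * (d / x) * (e / x^2) * ((f / x^4) * (g / x^4)) = 4 * c * d * e * (f * g) / x^12"
   and e2: "(X / x) * (Y / x^2) * (q / x^8) = X * Y * q / x^11"
   by (simp_all only: times_divide_eq_left times_divide_eq_right divide_divide_eq_left mult_ac)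
  have "x ^ 12 = x * x ^ 11" by (simp add: eval_nat_numeral)
  then show ?thesis unfolding e1 e2 using assms by simp
qed

text \<open>This and the next limit belong to the recurrence for L_n / (W(1) ... W(n)): passing to
  index n + 1 brings in W(n+1) from index n and W(n) W(n+1) from n - 1. Leading terms give -2 * 30 /
  (4 * 4 * 4 * 5) and 5 / (4 * 4 * 4 * 5).\<close>

lemma first_coefficient_at_infinity:
  "((\<lambda>x. - (2 * (x + 1) * p_poly a b x)
     / (4 * (4 * x + 3) * (4 * x + 5) * (5 * x^2 - 2 * a^2 - 2 * b^2) * quartic a b (x + 1))) \<longlongrightarrow> - 3 / 16) at_infinity"
proof (rule tendsto_at_infinity_cong)
  show "((\<lambda>x. - (2 * ((1 * x + 1) / x) * (p_poly a b x / x^7))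
     / (4 * ((4 * x + 3) / x) * ((4 * x + 5) / x) * ((5 * x^2 - 2 * a^2 - 2 * b^2) / x^2) * (quartic a b (x + 1) / x^4)))
      \<longlongrightarrow> - (2 * 1 * 30) / (4 * 4 * 4 * 5 * 1)) at_infinity"
    by (intro tendsto_intros linear_at_infinity p_poly_at_infinity quadratic_at_infinity quartic_shift_at_infinity) simp_all
  fix x :: complex assume "x \<noteq> 0"
  then show "- (2 * ((1 * x + 1) / x) * (p_poly a b x / x^7))
     / (4 * ((4 * x + 3) / x) * ((4 * x + 5) / x) * ((5 * x^2 - 2 * a^2 - 2 * b^2) / x^2) * (quartic a b (x + 1) / x^4))
     = - (2 * (x + 1) * p_poly a b x)
     / (4 * (4 * x + 3) * (4 * x + 5) * (5 * x^2 - 2 * a^2 - 2 * b^2) * quartic a b (x + 1))"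
    unfolding mult_1_left by (rule first_coefficient_cancel)
qed simp

lemma second_coefficient_at_infinity:
  "((\<lambda>x. x * (x + 1) * (5 * (x + 1)^2 - 2 * a^2 - 2 * b^2) * q_poly a b x
     / (4 * (4 * x + 3) * (4 * x + 5) * (5 * x^2 - 2 * a^2 - 2 * b^2) * (quartic a b x * quartic a b (x + 1)))) \<longlongrightarrow> 1 / 64) at_infinity"
proof (rule tendsto_at_infinity_cong)
  show "((\<lambda>x. ((1 * x + 1) / x) * ((5 * (x + 1)^2 - 2 * a^2 - 2 * b^2) / x^2) * (q_poly a b x / x^8)
     / (4 * ((4 * x + 3) / x) * ((4 * x + 5) / x) * ((5 * x^2 - 2 * a^2 - 2 * b^2) / x^2)
         * ((quartic a b x / x^4) * (quartic a b (x + 1) / x^4))))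
      \<longlongrightarrow> 1 * 5 * 1 / (4 * 4 * 4 * 5 * (1 * 1))) at_infinity"
    by (intro tendsto_intros linear_at_infinity q_poly_at_infinity quadratic_at_infinity
          quadratic_shift_at_infinity quartic_at_infinity quartic_shift_at_infinity) simp_all
  fix x :: complex assume "x \<noteq> 0"
  then show "((1 * x + 1) / x) * ((5 * (x + 1)^2 - 2 * a^2 - 2 * b^2) / x^2) * (q_poly a b x / x^8)
     / (4 * ((4 * x + 3) / x) * ((4 * x + 5) / x) * ((5 * x^2 - 2 * a^2 - 2 * b^2) / x^2)
         * ((quartic a b x / x^4) * (quartic a b (x + 1) / x^4)))
     = x * (x + 1) * (5 * (x + 1)^2 - 2 * a^2 - 2 * b^2) * q_poly a b x
     / (4 * (4 * x + 3) * (4 * x + 5) * (5 * x^2 - 2 * a^2 - 2 * b^2) * (quartic a b x * quartic a b (x + 1)))"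
    unfolding mult_1_left by (rule second_coefficient_cancel)
qed simp

lemma odd_coefficient_at_infinity:
  "((\<lambda>x. - (x * ((x^2 - (a^2 + b^2))^2 - 4 * a^2 * b^2)) / (2 * (2 * x + 1) * quartic a b x)) \<longlongrightarrow> - 1 / 4) at_infinity"
proof (rule tendsto_at_infinity_cong)
  show "((\<lambda>x. - (((x^2 - (a^2 + b^2))^2 - 4 * a^2 * b^2) / x^4) / (2 * ((2 * x + 1) / x) * (quartic a b x / x^4)))
      \<longlongrightarrow> - 1 / (2 * 2 * 1)) at_infinity"
    by (intro tendsto_intros linear_at_infinity odd_factor_at_infinity quartic_at_infinity) simp_all
  fix x :: complex assume "x \<noteq> 0"
  then show "- (((x^2 - (a^2 + b^2))^2 - 4 * a^2 * b^2) / x^4) / (2 * ((2 * x + 1) / x) * (quartic a b x / x^4))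
     = - (x * ((x^2 - (a^2 + b^2))^2 - 4 * a^2 * b^2)) / (2 * (2 * x + 1) * quartic a b x)"
    by (simp add: divide_simps)
qed simp

lemma of_nat_Suc_at_infinity: "filterlim (\<lambda>n. of_nat (Suc n) :: complex) at_infinity sequentially"
  by (rule filterlim_compose[OF tendsto_of_nat filterlim_Suc])

subsection \<open>The kernel\<close>

locale unit_disc_pair =
  fixes a b :: complex
  assumes norm_a: "norm a < 1" and norm_b: "norm b < 1"
begin

abbreviation W :: "nat \<Rightarrow> complex" where "W m \<equiv> quartic a b (of_nat m)"

definition P :: "nat \<Rightarrow> nat \<Rightarrow> complex" where
  "P n k = (\<Prod>m = 1..Suc n. W (k + m))"

section \<open>Growth of W and of its products\<close>

lemma norm_square_diff_ge:
  fixes c :: complex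
  assumes "norm c < 1"
  shows "(1 - norm c ^ 2) * real m ^ 2 \<le> norm (of_nat m ^ 2 - c ^ 2)"
proof (cases "m = 0")
  case False
  then have "norm c ^ 2 * 1 \<le> norm c ^ 2 * real m ^ 2"
    by (intro mult_left_mono) auto
  moreover have "norm (of_nat m ^ 2 :: complex) - norm (c ^ 2) \<le> norm (of_nat m ^ 2 - c ^ 2)"
    by (rule norm_triangle_ineq2)
  ultimately show ?thesis by (simp add: norm_power algebra_simps)
qed simp

text \<open>A nonzero shift raises m^2 by at least 2, which pays for |c|^2 <= 1 being lost twice,
  once in the upper and once in the lower triangle bound.\<close>

lemma norm_square_diff_shift:
  fixes c :: complex
  assumes c: "norm c < 1" and m: "m \<ge> 1"
  shows "norm (of_nat m ^ 2 - c ^ 2) \<le> norm (of_nat (k + m) ^ 2 - c ^ 2)"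
proof (cases "k = 0")
  case False
  have c1: "norm (c ^ 2) \<le> 1" using c by (simp add: norm_power power_le_one)
  have "m * m + 2 \<le> (k + m) * (k + m)"
  proof -
    have "(m + 1) * (m + 1) \<le> (k + m) * (k + m)" using False by (intro mult_le_mono) auto
    then show ?thesis using m by simp
  qed
  then have "real (m * m + 2) \<le> real ((k + m) * (k + m))" by (rule of_nat_mono)
  then have km: "real m ^ 2 + 2 \<le> real (k + m) ^ 2" by (simp add: power2_eq_square)
  have "norm (of_nat m ^ 2 - c ^ 2) \<le> norm (of_nat m ^ 2 :: complex) + norm (c ^ 2)"
    by (rule norm_triangle_ineq4)
  also have "\<dots> \<le> norm (of_nat (k + m) ^ 2 :: complex) - norm (c ^ 2)"
    using c1 km by (simp add: norm_power del: of_nat_add)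
  also have "\<dots> \<le> norm (of_nat (k + m) ^ 2 - c ^ 2)" by (rule norm_triangle_ineq2)
  finally show ?thesis .
qed simp

definition \<kappa> :: real where "\<kappa> = (1 - norm a ^ 2) * (1 - norm b ^ 2)"

lemma \<kappa>_pos: "\<kappa> > 0"
  using norm_a norm_b by (simp add: \<kappa>_def power_less_one_iff)

lemma norm_W_ge: "\<kappa> * real m ^ 4 \<le> norm (W m)"
proof -
  have "((1 - norm a ^ 2) * real m ^ 2) * ((1 - norm b ^ 2) * real m ^ 2) \<le> norm (W m)"
    unfolding quartic_def norm_mult using norm_a norm_b
    by (intro mult_mono norm_square_diff_ge) (auto simp: power_le_one)
  then show ?thesis by (simp add: \<kappa>_def mult_ac power4_eq_xxxx power2_eq_square)
qed

lemma norm_W_shift: "m \<ge> 1 \<Longrightarrow> norm (W m) \<le> norm (W (k + m))"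
  unfolding quartic_def norm_mult by (intro mult_mono norm_square_diff_shift norm_a norm_b) auto

lemma W_nonzero: "m \<ge> 1 \<Longrightarrow> W m \<noteq> 0"
  using norm_W_ge[of m] \<kappa>_pos by (auto simp: mult_le_0_iff)

lemma P_nonzero: "P n k \<noteq> 0"
  unfolding P_def by (simp add: prod_zero_iff W_nonzero del: of_nat_add prod.cl_ivl_Suc)

lemma P_Suc: "P (Suc n) k = P n k * W (k + n + 2)"
  unfolding P_def by (simp add: algebra_simps)

lemma P_Suc_left: "P (Suc n) k = W (Suc k) * P n (Suc k)"
  unfolding P_def by (subst prod.atLeast_Suc_atMost) (simp_all add: prod.shift_bounds_cl_Suc_ivl add_ac del: prod.cl_ivl_Suc)

text \<open>The factor W(k+1) supplies the growth in k, and every other factor is at least its value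
  at k = 0 by \<open>norm_W_shift\<close>. Dividing by |W 1| completes those values to P n 0. The
  constant is independent of n.\<close>

lemma norm_P_ge:
  "\<kappa> / norm (W 1) * real (Suc k) ^ 4 * norm (P n 0) \<le> norm (P n k)"
proof -
  have split: "P n k = W (Suc k) * (\<Prod>m = 2..Suc n. W (k + m))" for k
    unfolding P_def by (subst prod.atLeast_Suc_atMost) (simp_all add: numeral_2_eq_2 del: prod.cl_ivl_Suc)
  have "\<kappa> / norm (W 1) * real (Suc k) ^ 4 * norm (P n 0) = \<kappa> * real (Suc k) ^ 4 * norm (\<Prod>m = 2..Suc n. W m)"
    using W_nonzero[of 1] by (simp add: split norm_mult)
  also have "\<dots> \<le> norm (W (Suc k)) * norm (\<Prod>m = 2..Suc n. W (k + m))"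
    using \<kappa>_pos by (intro mult_mono norm_W_ge) (auto simp: prod_norm[symmetric] intro!: prod_mono prod_nonneg norm_W_shift simp del: prod.cl_ivl_Suc of_nat_add)
  also have "\<dots> = norm (P n k)" by (simp add: split norm_mult)
  finally show ?thesis .
qed

lemma leading_nonzero: "m \<ge> 1 \<Longrightarrow> 5 * of_nat m ^ 2 - 2 * a^2 - 2 * b^2 \<noteq> 0"
proof
  assume m: "m \<ge> 1" and eq: "5 * of_nat m ^ 2 - 2 * a^2 - 2 * b^2 = 0"
  have "norm (2 * a^2 + 2 * b^2) \<le> norm (2 * a^2) + norm (2 * b^2)" by (rule norm_triangle_ineq)
  also have "\<dots> = 2 * norm a ^ 2 + 2 * norm b ^ 2" by (simp add: norm_mult norm_power)
  also have "\<dots> < 5 * 1"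
    using power_le_one[of "norm a" 2] power_le_one[of "norm b" 2] norm_a norm_b by simp
  also have "\<dots> \<le> 5 * real m ^ 2" using m by (intro mult_left_mono) auto
  also have "\<dots> = norm (5 * of_nat m ^ 2 :: complex)" by (simp add: norm_mult norm_power)
  also have "5 * of_nat m ^ 2 = 2 * a^2 + 2 * b^2" using eq by (simp add: algebra_simps)
  finally show False by simp
qed

text \<open>Since 1 <= z <= (n+1)(k+1), the numerator is at most a multiple of (n+1)^2 (k+1)^2,
  against (k+1)^4 below. The bound splits into a factor in n and a factor in k, so one convergent
  series serves all n.\<close>

lemma norm_quadratic_over_P_le:
  fixes n :: nat and c0 c1 c2 :: complex
  defines "z \<equiv> \<lambda>k. of_nat k + 1 + of_nat n / 2"
  shows "norm ((c0 + c1 * z k + c2 * z k ^ 2) / P n k)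
    \<le> (norm c0 + norm c1 + norm c2) * real (Suc n) ^ 2 / (\<kappa> / norm (W 1) * norm (P n 0)) * (1 / real (Suc k) ^ 2)"
proof -
  define \<zeta> where "\<zeta> = real k + 1 + real n / 2"
  have "z k = of_real \<zeta>" by (simp add: z_def \<zeta>_def)
  moreover have \<zeta>1: "\<zeta> \<ge> 1" by (simp add: \<zeta>_def)
  ultimately have nz: "norm (z k) = \<zeta>" by simp
  have "norm (c0 + c1 * z k + c2 * z k ^ 2) \<le> norm c0 + norm c1 * \<zeta> + norm c2 * \<zeta> ^ 2"
    by (intro order.trans[OF norm_triangle_ineq] add_mono) (auto simp: norm_mult norm_power nz)
  also have "\<dots> \<le> norm c0 * \<zeta> ^ 2 + norm c1 * \<zeta> ^ 2 + norm c2 * \<zeta> ^ 2"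
    using \<zeta>1 by (intro add_mono mult_left_mono) (auto simp: power2_eq_square mult_le_cancel_left1 intro: mult_ge1_I)
  also have "\<dots> = (norm c0 + norm c1 + norm c2) * \<zeta> ^ 2" by (simp add: algebra_simps)
  also have "\<dots> \<le> (norm c0 + norm c1 + norm c2) * (real (Suc n) * real (Suc k)) ^ 2"
    using \<zeta>1 by (intro mult_left_mono power_mono) (auto simp: \<zeta>_def algebra_simps)
  finally have num: "norm (c0 + c1 * z k + c2 * z k ^ 2) \<le> (norm c0 + norm c1 + norm c2) * (real (Suc n) * real (Suc k)) ^ 2" .
  have pos: "0 < \<kappa> / norm (W 1) * real (Suc k) ^ 4 * norm (P n 0)"
    using \<kappa>_pos W_nonzero[of 1] P_nonzero by simp
  have "norm ((c0 + c1 * z k + c2 * z k ^ 2) / P n k)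
     \<le> ((norm c0 + norm c1 + norm c2) * (real (Suc n) * real (Suc k)) ^ 2) / (\<kappa> / norm (W 1) * real (Suc k) ^ 4 * norm (P n 0))"
    unfolding norm_divide by (rule frac_le[OF _ num pos norm_P_ge]) simp
  also have "\<dots> = (norm c0 + norm c1 + norm c2) * real (Suc n) ^ 2 / (\<kappa> / norm (W 1) * norm (P n 0)) * (1 / real (Suc k) ^ 2)"
    by (simp add: power_mult_distrib power4_eq_xxxx power2_eq_square mult_ac del: of_nat_Suc)
  finally show ?thesis .
qed

lemma cubic_over_P_tendsto_0:
  fixes n :: nat and c0 c1 c2 c3 :: complex
  defines "z \<equiv> \<lambda>k. of_nat k + 1 + of_nat n / 2"
  shows "(\<lambda>k. (c0 + c1 * z k + c2 * z k ^ 2 + c3 * z k ^ 3) / P n k) \<longlonglongrightarrow> 0"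
proof -
  define u where "u k = 1 / (of_nat (Suc k) :: complex)" for k
  have u: "u \<longlonglongrightarrow> 0" unfolding u_def using LIMSEQ_Suc[OF lim_1_over_n] by simp
  \<comment> \<open>z k / (k+1), which tends to 1. The numerator over (k+1)^4 becomes a polynomial
    in \<open>u\<close> and \<zeta> in which every term contains \<open>u\<close>.\<close>
  define \<zeta> where "\<zeta> k = 1 + of_nat n / 2 * u k" for k
  have z: "z k = of_nat (Suc k) * \<zeta> k" for k
    unfolding z_def \<zeta>_def u_def by (simp add: field_simps del: of_nat_Suc) (simp add: algebra_simps)
  have \<zeta>: "\<zeta> \<longlonglongrightarrow> 1 + of_nat n / 2 * 0" unfolding \<zeta>_def by (intro tendsto_intros u)
  define f where "f k = c0 * u k ^ 4 + c1 * u k ^ 3 * \<zeta> k + c2 * u k ^ 2 * \<zeta> k ^ 2 + c3 * u k * \<zeta> k ^ 3" for k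
  have "f \<longlonglongrightarrow> 0" unfolding f_def by (rule tendsto_eq_intros u \<zeta> refl | simp)+
  then show ?thesis
  proof (rule tendsto_0_le, intro always_eventually allI)
    fix k
    have nz: "of_nat (Suc k) \<noteq> (0 :: complex)" by (rule of_nat_neq_0)
    have num: "c0 + c1 * z k + c2 * z k ^ 2 + c3 * z k ^ 3 = of_nat (Suc k) ^ 4 * f k"
      unfolding z f_def u_def using nz by (simp add: field_simps eval_nat_numeral del: of_nat_Suc)
    have pos: "0 < \<kappa> / norm (W 1) * real (Suc k) ^ 4 * norm (P n 0)"
      using \<kappa>_pos W_nonzero[of 1] P_nonzero by simp
    have "norm ((c0 + c1 * z k + c2 * z k ^ 2 + c3 * z k ^ 3) / P n k)
        \<le> (real (Suc k) ^ 4 * norm (f k)) / (\<kappa> / norm (W 1) * real (Suc k) ^ 4 * norm (P n 0))"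
      unfolding norm_divide num norm_mult norm_power norm_of_nat by (rule frac_le[OF _ _ pos norm_P_ge]) simp_all
    then show "norm ((c0 + c1 * z k + c2 * z k ^ 2 + c3 * z k ^ 3) / P n k)
        \<le> norm (f k) * (1 / (\<kappa> / norm (W 1) * norm (P n 0)))"
      by (simp del: of_nat_Suc)
  qed
qed

lemma P_0: "P n 0 = (\<Prod>m = 1..n. W m) * W (Suc n)"
  by (simp add: P_def)

text \<open>The \<open>n\<close>-th step of the transformation uses the paper's index \<open>x = n + 1\<close>.\<close>

definition slope :: "(nat \<Rightarrow> complex) \<Rightarrow> nat \<Rightarrow> complex" where
  "slope L n = (let x = of_nat (Suc n) in
     ((4 * x + 1) * L (Suc n) - x * even_defect a b x * L n) / (x * (5 * x^2 - 2 * a^2 - 2 * b^2)))"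

text \<open>\<open>slope L n\<close> and \<open>L n\<close> play the roles of s and t in
  \<open>even_step\<close>; \<open>slope\<close> is solved from the demand that C' equal the next
  \<open>C\<close>.\<close>

definition A :: "(nat \<Rightarrow> complex) \<Rightarrow> nat \<Rightarrow> complex" where
  "A L n = (let x = of_nat (Suc n) in (4 * x - 1) * slope L n - even_shift a b x * L n)"

definition C :: "(nat \<Rightarrow> complex) \<Rightarrow> nat \<Rightarrow> complex" where
  "C L n = (4 * of_nat (Suc n) - 3) * L n"

text \<open>The coefficient t of \<open>odd_step\<close>: its first-order recurrence unrolled from
  the initial value B0/2.\<close>

definition \<tau> :: "complex \<Rightarrow> nat \<Rightarrow> complex" where
  "\<tau> B0 n = (-1)^n * B0 * fact n / 2^(n + 1)
     * (\<Prod>m = 1..n. ((of_nat m^2 - (a^2 + b^2))^2 - 4 * a^2 * b^2) / (2 * of_nat m + 1))"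

definition B :: "complex \<Rightarrow> nat \<Rightarrow> complex" where
  "B B0 n = (4 * of_nat (Suc n) - 2) * \<tau> B0 n"

section \<open>Recursions for the coefficients\<close>

lemma \<tau>_Suc:
  "\<tau> B0 (Suc n) = - (of_nat (Suc n) * ((of_nat (Suc n)^2 - (a^2 + b^2))^2 - 4 * a^2 * b^2))
     / (2 * (2 * of_nat (Suc n) + 1)) * \<tau> B0 n"
  unfolding \<tau>_def by (simp add: mult_ac)

lemma B_Suc:
  "B B0 (Suc n) = - of_nat (Suc n) * ((of_nat (Suc n)^2 - (a^2 + b^2))^2 - 4 * a^2 * b^2) * \<tau> B0 n"
proof -
  define x :: complex where "x = of_nat (Suc n)"
  have "2 * x + 1 = of_nat (2 * Suc n + 1)" by (simp add: x_def)
  then have nz: "2 * x + 1 \<noteq> 0" by (metis Suc_eq_plus1 of_nat_neq_0)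
  have "B B0 (Suc n) = 2 * (2 * x + 1) * \<tau> B0 (Suc n)" by (simp add: B_def x_def algebra_simps)
  also have "\<dots> = - x * ((x^2 - (a^2 + b^2))^2 - 4 * a^2 * b^2) * \<tau> B0 n"
  proof -
    have "2 * w * (- (x * q) / (2 * w) * t) = - x * q * t" if "w \<noteq> 0" for w q t
      using that by simp
    from this[OF nz] show ?thesis unfolding \<tau>_Suc x_def[symmetric] .
  qed
  finally show ?thesis unfolding x_def .
qed

lemma slope_eq:
  fixes n defines "x \<equiv> of_nat (Suc n) :: complex"
  shows "x * (5 * x^2 - 2 * a^2 - 2 * b^2) * slope L n = (4 * x + 1) * L (Suc n) - x * even_defect a b x * L n"
  using leading_nonzero[of "Suc n"] of_nat_neq_0[of n, where 'a = complex]
  unfolding slope_def Let_def x_def[symmetric] by simp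

lemma C_Suc:
  fixes n defines "x \<equiv> of_nat (Suc n) :: complex"
  shows "C L (Suc n) = x * (5 * x^2 - 2 * (a^2 + b^2)) * slope L n + x * even_defect a b x * L n"
  using slope_eq[of n L] unfolding C_def x_def[symmetric] by (simp add: x_def algebra_simps)

lemma odd_decay: "(\<lambda>n. of_nat (Suc n) ^ j * (\<tau> B0 n / (\<Prod>m = 1..n. W m))) \<longlonglongrightarrow> 0"
proof -
  let ?f = "\<lambda>x. - (x * ((x^2 - (a^2 + b^2))^2 - 4 * a^2 * b^2)) / (2 * (2 * x + 1) * quartic a b x)"
  \<comment> \<open>The first-order recurrence is read as a second-order one with zero last
    coefficient, so it is used from n + 1 to n + 2; hence the double successor.\<close>
  have "(\<lambda>n. ?f (of_nat (Suc (Suc n)))) \<longlonglongrightarrow> - 1 / 4"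
    using LIMSEQ_Suc[OF filterlim_compose[OF odd_coefficient_at_infinity of_nat_Suc_at_infinity]] .
  then show ?thesis
  proof (rule linear_recurrence_decay[rotated])
    show "(\<lambda>n. 0) \<longlonglongrightarrow> (0 :: complex)" by simp
    show "norm (- 1 / 4 :: complex) / 2 + norm (0 :: complex) < 1 / 4" by simp
    show "\<tau> B0 (Suc (Suc n)) / (\<Prod>m = 1..Suc (Suc n). W m)
       = ?f (of_nat (Suc (Suc n))) * (\<tau> B0 (Suc n) / (\<Prod>m = 1..Suc n. W m)) + 0 * (\<tau> B0 n / (\<Prod>m = 1..n. W m))" for n
      by (subst \<tau>_Suc[of _ "Suc n"], subst prod.nat_ivl_Suc', simp) (simp del: of_nat_Suc prod.cl_ivl_Suc)
  qed
qed

end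

subsection \<open>The accelerated series\<close>

locale accelerated_series = unit_disc_pair +
  fixes A0 B0 C0 :: complex and L :: "nat \<Rightarrow> complex"
  assumes L_0: "L 0 = C0"
    and L_1: "L 1 = (1/3 - 2/15 * (a^2 + b^2)) * A0
      + (1/6 * (a^2 + b^2) - 2/15 * (a^4 + b^4 - 4 * a^2 * b^2) - 1/30) * C0"
    and L_rec: "\<And>n. n \<ge> 1 \<Longrightarrow>
      4 * (4 * of_nat n + 3) * (4 * of_nat n + 5) * (5 * of_nat n^2 - 2 * a^2 - 2 * b^2) * L (n + 1)
      + 2 * (of_nat n + 1) * p_poly a b (of_nat n) * L n
      - of_nat n * (of_nat n + 1) * (5 * (of_nat n + 1)^2 - 2 * a^2 - 2 * b^2)
          * q_poly a b (of_nat n) * L (n - 1) = 0"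
begin

text \<open>The prescribed \<open>L 1\<close> is exactly the value whose slope at x = 1 gives the
  constant coefficient A0.\<close>

lemma A_0: "A L 0 = A0"
proof -
  define D where "D = 5 - 2 * a^2 - 2 * b^2"
  have nz: "D \<noteq> 0" using leading_nonzero[of 1] by (simp add: D_def)
  have "D * slope L 0 = 5 * L 1 - even_defect a b 1 * C0"
    using slope_eq[of 0 L] by (simp add: D_def L_0)
  then have "D * A L 0 = D * A0"
    unfolding A_def Let_def L_1 even_defect_def even_shift_def D_def using L_0
    by (simp add: field_simps, algebra)
  then show ?thesis using nz by simp
qed

lemma B_0: "B B0 0 = B0"
  by (simp add: B_def \<tau>_def)

lemma C_0: "C L 0 = C0"
  by (simp add: C_def L_0)

text \<open>For \<open>C\<close> the step holds by the choice of \<open>slope\<close>; for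
  \<open>A\<close> it is a genuine condition, and here the recurrence of \<open>L\<close>
  enters.\<close>

lemma A_Suc:
  fixes n defines "x \<equiv> of_nat (Suc n) :: complex"
  shows "A L (Suc n) = x * quartic a b (x / 2) * (4 * slope L n + (2 * (a^2 + b^2) - 5 * x^2 + 8 * x - 3) * L n)"
proof -
  have x1: "of_nat (Suc (Suc n)) = x + 1" by (simp add: x_def)
  have "(4 * x + 3) * slope L (Suc n) - even_shift a b (x + 1) * L (Suc n)
     = x * quartic a b (x / 2) * (4 * slope L n + (2 * (a^2 + b^2) - 5 * x^2 + 8 * x - 3) * L n)"
  proof (rule even_recurrence)
    show "x + 1 \<noteq> 0" unfolding x1[symmetric] by (rule of_nat_neq_0)
    show "5 * x^2 - 2 * a^2 - 2 * b^2 \<noteq> 0" "5 * (x + 1)^2 - 2 * a^2 - 2 * b^2 \<noteq> 0"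
      using leading_nonzero[of "Suc n"] leading_nonzero[of "Suc (Suc n)"] unfolding x1 x_def[symmetric] by simp_all
    show "x * (5 * x^2 - 2 * a^2 - 2 * b^2) * slope L n = (4 * x + 1) * L (Suc n) - x * even_defect a b x * L n"
      using slope_eq[of n L] unfolding x_def[symmetric] .
    show "(x + 1) * (5 * (x + 1)^2 - 2 * a^2 - 2 * b^2) * slope L (Suc n)
       = (4 * x + 5) * L (Suc (Suc n)) - (x + 1) * even_defect a b (x + 1) * L (Suc n)"
      using slope_eq[of "Suc n" L] unfolding x1 by (simp add: algebra_simps)
    show "4 * (4 * x + 3) * (4 * x + 5) * (5 * x^2 - 2 * a^2 - 2 * b^2) * L (Suc (Suc n))
      + 2 * (x + 1) * p_poly a b x * L (Suc n)
      - x * (x + 1) * (5 * (x + 1)^2 - 2 * a^2 - 2 * b^2) * q_poly a b x * L n = 0"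
      using L_rec[of "Suc n"] unfolding x_def[symmetric] by simp
  qed
  then show ?thesis unfolding A_def Let_def x1 by (simp add: algebra_simps)
qed

text \<open>Here k counts from 0, so the denominator is W(k+1) ... W(k+n+1) and z is the midpoint of
  this range.\<close>

definition F :: "nat \<Rightarrow> nat \<Rightarrow> complex" where
  "F n k = (let z = of_nat k + 1 + of_nat n / 2 in (A L n + B B0 n * z + C L n * z^2) / P n k)"

definition G :: "nat \<Rightarrow> nat \<Rightarrow> complex" where
  "G n k = (let z = of_nat k + 1 + of_nat n / 2; x = of_nat (Suc n) in
     (slope L n * z + L n * z^3 + (A L n + C L n * z^2) / 2
      + ((5 * x^2 / 2 - (a^2 + b^2) - 2 * x + 1/2) / 2 * \<tau> B0 n + \<tau> B0 n * z^2 + B B0 n * z / 2)) / P n k)"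

lemma F_diff: "F n k - F (Suc n) k = G n k - G n (Suc k)"
proof -
  define x :: complex where "x = of_nat (Suc n)"
  define y where "y = of_nat k + 1 + x / 2"
  define Qe Qo Te To
    where "Qe z = A L n + C L n * z^2" and "Qo z = B B0 n * z"
      and "Te z = slope L n * z + L n * z^3"
      and "To z = (5 * x^2 / 2 - (a^2 + b^2) - 2 * x + 1/2) / 2 * \<tau> B0 n + \<tau> B0 n * z^2" for z
  have z: "of_nat k + 1 + of_nat n / 2 = y - 1/2" "of_nat (Suc k) + 1 + of_nat n / 2 = y + 1/2"
    "of_nat k + 1 + of_nat (Suc n) / 2 = y"
    by (simp_all add: y_def x_def field_simps)
  define w0 w1 where "w0 = W (Suc k)" and "w1 = W (k + n + 2)"
  have w: "quartic a b (y - x / 2) = w0" "quartic a b (y + x / 2) = w1"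
    by (simp_all add: w0_def w1_def y_def x_def add_ac)
  have nz: "w0 \<noteq> 0" "w1 \<noteq> 0"
    unfolding w0_def w1_def by (auto intro!: W_nonzero simp del: of_nat_Suc of_nat_add)
  have A: "A L n = (4 * x - 1) * slope L n - even_shift a b x * L n"
    by (simp add: A_def x_def Let_def)
  have even: "A L (Suc n) + C L (Suc n) * y^2
     = (Te (y + 1/2) + Qe (y + 1/2) / 2) * w0 - (Te (y - 1/2) - Qe (y - 1/2) / 2) * w1"
    unfolding A_Suc C_Suc unfolding Te_def Qe_def A C_def x_def[symmetric] w[symmetric] by (rule even_step)
  have odd: "B B0 (Suc n) * y
     = (To (y + 1/2) + Qo (y + 1/2) / 2) * w0 - (To (y - 1/2) - Qo (y - 1/2) / 2) * w1"
    unfolding B_Suc unfolding To_def Qo_def B_def x_def[symmetric] w[symmetric] by (rule odd_step)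
  \<comment> \<open>The two products run over windows that differ by one factor at each end.\<close>
  have "P n k * w1 = w0 * P n (Suc k)"
    unfolding w0_def w1_def P_Suc[symmetric] P_Suc_left ..
  then have P': "P n (Suc k) = P n k * w1 / w0"
    using nz by (simp add: nonzero_eq_divide_eq mult.commute)
  have F: "F n k = (Qe (y - 1/2) + Qo (y - 1/2)) / P n k"
    "F (Suc n) k = ((A L (Suc n) + C L (Suc n) * y^2) + B B0 (Suc n) * y) / (P n k * w1)"
    unfolding F_def Let_def z P_Suc w1_def Qe_def Qo_def by (simp_all add: add_ac del: of_nat_add)
  have G: "G n k = (Te (y - 1/2) + Qe (y - 1/2) / 2 + (To (y - 1/2) + Qo (y - 1/2) / 2)) / P n k"
    "G n (Suc k) = (Te (y + 1/2) + Qe (y + 1/2) / 2 + (To (y + 1/2) + Qo (y + 1/2) / 2)) / (P n k * w1 / w0)"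
    unfolding G_def Let_def z P'[symmetric] Qe_def Qo_def Te_def To_def x_def by simp_all
  \<comment> \<open>Over the common denominator p * w1 both sides have the same numerator. Primed
    letters stand for values at y + 1/2, unprimed ones for values at y - 1/2.\<close>
  have "(qe + qo) / p - (((t' + q' / 2) * w0 - (t - qe / 2) * w1) + ((u' + r' / 2) * w0 - (u - qo / 2) * w1)) / (p * w1)
      = (t + qe / 2 + (u + qo / 2)) / p - (t' + q' / 2 + (u' + r' / 2)) / (p * w1 / w0)"
    if "p \<noteq> 0" for p qe qo q' r' t t' u u'
  proof -
    have "(qe + qo) / p = ((qe + qo) * w1) / (p * w1)"
      "(t + qe / 2 + (u + qo / 2)) / p = ((t + qe / 2 + (u + qo / 2)) * w1) / (p * w1)"
      using nz by simp_all
    then show ?thesis using nz by (simp add: diff_divide_distrib[symmetric] algebra_simps)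
  qed
  from this[OF P_nonzero] show ?thesis unfolding F G even odd .
qed

lemma G_0: "G n 0 = d_coeff a b B0 L (Suc n) / (\<Prod>m = 1..Suc n. (of_nat m^2 - a^2) * (of_nat m^2 - b^2))"
proof -
  define x :: complex where "x = of_nat (Suc n)"
  define z where "z = (x + 1) / 2"
  have z': "of_nat 0 + 1 + of_nat n / 2 = z" by (simp add: z_def x_def field_simps)
  have D: "5 * x^2 - 2 * a^2 - 2 * b^2 \<noteq> 0" using leading_nonzero[of "Suc n"] unfolding x_def by simp
  have A: "A L n = (4 * x - 1) * slope L n - even_shift a b x * L n" by (simp add: A_def x_def Let_def)
  have even: "slope L n * z + L n * z^3 + (A L n + C L n * z^2) / 2
    = (20 * x + 5) / (2 * (5 * x^2 - 2 * a^2 - 2 * b^2)) * L (Suc n)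
     + (35 * x^5 - 35 * x^3 * (a^2 + b^2) + 4 * x * (3 * a^4 + 3 * b^4 - 4 * a^2 * b^2))
       / (4 * (5 * x^2 - 2 * a^2 - 2 * b^2)) * L n"
    unfolding A C_def x_def[symmetric] z_def
    by (rule even_boundary[OF D]) (use slope_eq[of n L] in \<open>simp add: x_def\<close>)
  have odd: "(5 * x^2 / 2 - (a^2 + b^2) - 2 * x + 1/2) / 2 * \<tau> B0 n + \<tau> B0 n * z^2 + B B0 n * z / 2
    = (5 * x^2 - a^2 - b^2) / 2 * \<tau> B0 n"
    unfolding B_def x_def[symmetric] z_def by (rule odd_boundary)
  have "d_coeff a b B0 L (Suc n) = (5 * x^2 - a^2 - b^2) / 2 * \<tau> B0 n
     + (20 * x + 5) / (2 * (5 * x^2 - 2 * a^2 - 2 * b^2)) * L (Suc n)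
     + (35 * x^5 - 35 * x^3 * (a^2 + b^2) + 4 * x * (3 * a^4 + 3 * b^4 - 4 * a^2 * b^2))
       / (4 * (5 * x^2 - 2 * a^2 - 2 * b^2)) * L n"
    unfolding d_coeff_def x_def[symmetric] \<tau>_def by (simp add: mult_ac)
  then show ?thesis
    unfolding G_def Let_def z' x_def[symmetric] even odd
    by (simp add: P_def quartic_def add_ac del: prod.cl_ivl_Suc)
qed

section \<open>Decay of the numerator coefficients\<close>

lemma even_decay: "(\<lambda>n. of_nat (Suc n) ^ j * (L n / (\<Prod>m = 1..n. W m))) \<longlonglongrightarrow> 0"
proof -
  let ?c = "\<lambda>x. - (2 * (x + 1) * p_poly a b x)
     / (4 * (4 * x + 3) * (4 * x + 5) * (5 * x^2 - 2 * a^2 - 2 * b^2) * quartic a b (x + 1))"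
  let ?e = "\<lambda>x. x * (x + 1) * (5 * (x + 1)^2 - 2 * a^2 - 2 * b^2) * q_poly a b x
     / (4 * (4 * x + 3) * (4 * x + 5) * (5 * x^2 - 2 * a^2 - 2 * b^2) * (quartic a b x * quartic a b (x + 1)))"
  show ?thesis
  proof (rule linear_recurrence_decay)
    show "(\<lambda>n. ?c (of_nat (Suc n))) \<longlonglongrightarrow> - 3 / 16"
      by (rule filterlim_compose[OF first_coefficient_at_infinity of_nat_Suc_at_infinity])
    show "(\<lambda>n. ?e (of_nat (Suc n))) \<longlonglongrightarrow> 1 / 64"
      by (rule filterlim_compose[OF second_coefficient_at_infinity of_nat_Suc_at_infinity])
    \<comment> \<open>3/32 + 1/64 = 7/64. The limiting characteristic roots are 1/16 and -1/4, well
      inside the radius 1/2.\<close>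
    show "norm (- 3 / 16 :: complex) / 2 + norm (1 / 64 :: complex) < 1 / 4" by simp
  next
    fix n
    define x :: complex where "x = of_nat (Suc n)"
    define M where "M = 4 * (4 * x + 3) * (4 * x + 5) * (5 * x^2 - 2 * a^2 - 2 * b^2)"
    define u v where "u = 2 * (x + 1) * p_poly a b x"
      and "v = x * (x + 1) * (5 * (x + 1)^2 - 2 * a^2 - 2 * b^2) * q_poly a b x"
    have "4 * x + 3 = of_nat (Suc (4 * n + 6))" "4 * x + 5 = of_nat (Suc (4 * n + 8))"
      by (simp_all add: x_def)
    then have M: "M \<noteq> 0" unfolding M_def mult_eq_0_iff
      using leading_nonzero[of "Suc n"] of_nat_neq_0 unfolding x_def by (metis One_nat_def le_add1 plus_1_eq_Suc zero_neq_numeral)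
    have rec: "M * L (Suc (Suc n)) = - u * L (Suc n) + v * L n"
      using L_rec[of "Suc n"] unfolding M_def u_def v_def x_def[symmetric] by (simp add: algebra_simps)
    have L2: "L (Suc (Suc n)) = (- u * L (Suc n) + v * L n) / M"
      using M by (subst rec[symmetric]) simp
    have W: "quartic a b x \<noteq> 0" "quartic a b (x + 1) \<noteq> 0"
      using W_nonzero[of "Suc n"] W_nonzero[of "Suc (Suc n)"] by (simp_all add: x_def add_ac)
    have x1: "of_nat (Suc (Suc n)) = x + 1" by (simp add: x_def)
    have P: "(\<Prod>m = 1..n. W m) \<noteq> 0" using W_nonzero by auto
    have "L (Suc (Suc n)) / (\<Prod>m = 1..Suc (Suc n). W m)
       = - u / (M * quartic a b (x + 1)) * (L (Suc n) / (\<Prod>m = 1..Suc n. W m))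
       + v / (M * (quartic a b x * quartic a b (x + 1))) * (L n / (\<Prod>m = 1..n. W m))"
      using M W P by (simp add: x1 x_def[symmetric] L2 field_simps del: of_nat_Suc)
    then show "L (Suc (Suc n)) / (\<Prod>m = 1..Suc (Suc n). W m)
       = ?c (of_nat (Suc n)) * (L (Suc n) / (\<Prod>m = 1..Suc n. W m))
       + ?e (of_nat (Suc n)) * (L n / (\<Prod>m = 1..n. W m))"
      unfolding u_def v_def M_def x_def .
  qed
qed

lemma coefficients_decay:
  shows A_decay: "(\<lambda>n. A L n * of_nat (Suc n)^2 / P n 0) \<longlonglongrightarrow> 0"
    and B_decay: "(\<lambda>n. B B0 n * of_nat (Suc n)^2 / P n 0) \<longlonglongrightarrow> 0"
    and C_decay: "(\<lambda>n. C L n * of_nat (Suc n)^2 / P n 0) \<longlonglongrightarrow> 0"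
proof -
  define x :: "nat \<Rightarrow> complex" where "x n = of_nat (Suc n)" for n
  define \<rho> where "\<rho> n = L n / (\<Prod>m = 1..n. W m)" for n
  define \<theta> where "\<theta> n = \<tau> B0 n / (\<Prod>m = 1..n. W m)" for n
  have x0: "x n \<noteq> 0" for n unfolding x_def by (rule of_nat_neq_0)
  have x_lim: "filterlim x at_infinity sequentially"
    unfolding x_def by (rule of_nat_Suc_at_infinity)
  have W0: "quartic a b (x n) \<noteq> 0" for n using W_nonzero[of "Suc n"] by (simp add: x_def)
  have P0: "P n 0 = (\<Prod>m = 1..n. W m) * quartic a b (x n)" for n by (simp add: P_0 x_def)
  have \<rho>: "(\<lambda>n. x n * \<rho> n) \<longlonglongrightarrow> 0" "\<rho> \<longlonglongrightarrow> 0"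
    using even_decay[of 1] even_decay[of 0] by (simp_all add: x_def \<rho>_def[abs_def] del: of_nat_Suc)
  \<comment> \<open>x n = x (n+1) - 1 turns decay at the shifted index into decay with the unshifted
    weight.\<close>
  have "(\<lambda>n. x (Suc n) * \<rho> (Suc n) - \<rho> (Suc n)) \<longlonglongrightarrow> 0 - 0"
    by (intro tendsto_intros LIMSEQ_Suc[OF \<rho>(1)] LIMSEQ_Suc[OF \<rho>(2)])
  then have \<rho>_Suc: "(\<lambda>n. x n * \<rho> (Suc n)) \<longlonglongrightarrow> 0"
    by (simp add: x_def algebra_simps)
  have \<theta>: "\<theta> \<longlonglongrightarrow> 0"
    using odd_decay[of 0 B0] by (simp add: \<theta>_def[abs_def])
  have inv: "(\<lambda>n. inverse (x n)) \<longlonglongrightarrow> 0"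
    by (rule filterlim_compose[OF tendsto_inverse_0 x_lim])
  note lims = filterlim_compose[OF linear_at_infinity x_lim]
    filterlim_compose[OF quadratic_at_infinity[of a b] x_lim]
    filterlim_compose[OF quartic_at_infinity[of a b] x_lim]
    filterlim_compose[OF even_defect_at_infinity[of a b] x_lim]
    filterlim_compose[OF even_shift_at_infinity[of a b] x_lim]

  have cancel: "c / X / (w / X ^ 4) * inverse X * (l / p) = c * l * X ^ 2 / (p * w)"
    if "X \<noteq> 0" for c X w l p :: complex
  proof -
    have "c / X / (w / X ^ 4) * inverse X * (l / p) = c * l * (X ^ 4 / (X * X)) / (p * w)"
      by (simp add: divide_inverse mult_ac)
    also have "X ^ 4 / (X * X) = X ^ 2" using that by (simp add: eval_nat_numeral)
    finally show ?thesis .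
  qed

  have "(\<lambda>n. (4 * x n + - 3) / x n / (quartic a b (x n) / x n ^ 4) * inverse (x n) * \<rho> n) \<longlonglongrightarrow> 4 / 1 * 0 * 0"
    by (intro tendsto_intros lims inv \<rho>) simp_all
  moreover have "(4 * x n + - 3) / x n / (quartic a b (x n) / x n ^ 4) * inverse (x n) * \<rho> n
      = C L n * of_nat (Suc n)^2 / P n 0" for n
    unfolding C_def P0 \<rho>_def x_def[symmetric] cancel[OF x0] by simp
  ultimately show "(\<lambda>n. C L n * of_nat (Suc n)^2 / P n 0) \<longlonglongrightarrow> 0" by simp

  have "(\<lambda>n. (4 * x n + - 2) / x n / (quartic a b (x n) / x n ^ 4) * inverse (x n) * \<theta> n) \<longlonglongrightarrow> 4 / 1 * 0 * 0"
    by (intro tendsto_intros lims inv \<theta>) simp_all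
  moreover have "(4 * x n + - 2) / x n / (quartic a b (x n) / x n ^ 4) * inverse (x n) * \<theta> n
      = B B0 n * of_nat (Suc n)^2 / P n 0" for n
    unfolding B_def P0 \<theta>_def x_def[symmetric] cancel[OF x0] by simp
  ultimately show "(\<lambda>n. B B0 n * of_nat (Suc n)^2 / P n 0) \<longlonglongrightarrow> 0" by simp

  define D where "D n = 5 * x n^2 - 2 * a^2 - 2 * b^2" for n
  have D0: "D n \<noteq> 0" for n using leading_nonzero[of "Suc n"] by (simp add: D_def x_def)
  \<comment> \<open>The slope makes this the largest of the three: apart from bounded factors, x n *
    \<rho> (n+1) and x n * \<rho> n remain, so \<rho> has to beat one power of n.\<close>
  have "(\<lambda>n. (4 * x n + - 1) / x n * ((4 * x n + 1) / x n) / (D n / x n^2) * (x n * \<rho> (Suc n))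
      - (((4 * x n + - 1) / x n) * (even_defect a b (x n) / x n^4) / (D n / x n^2) + even_shift a b (x n) / x n^3)
        / (quartic a b (x n) / x n^4) * (x n * \<rho> n))
    \<longlonglongrightarrow> 4 * 4 / 5 * 0 - (4 * (- 29 / 4) / 5 + 5) / 1 * 0"
    unfolding D_def by (intro tendsto_intros lims \<rho> \<rho>_Suc) simp_all
  moreover have "(4 * x n + - 1) / x n * ((4 * x n + 1) / x n) / (D n / x n^2) * (x n * \<rho> (Suc n))
      - (((4 * x n + - 1) / x n) * (even_defect a b (x n) / x n^4) / (D n / x n^2) + even_shift a b (x n) / x n^3)
        / (quartic a b (x n) / x n^4) * (x n * \<rho> n) = A L n * of_nat (Suc n)^2 / P n 0" for n
  proof -
    define X w R Y p l0 l1 \<Delta> where "X = x n" and "w = quartic a b (x n)" and "R = even_defect a b (x n)"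
      and "Y = even_shift a b (x n)" and "p = (\<Prod>m = 1..n. W m)" and "l0 = L n" and "l1 = L (Suc n)" and "\<Delta> = D n"
    have nz: "X \<noteq> 0" "w \<noteq> 0" "p \<noteq> 0" "\<Delta> \<noteq> 0"
      unfolding X_def w_def p_def \<Delta>_def using x0 W0 D0 W_nonzero by auto
    have r: "\<rho> n = l0 / p" "\<rho> (Suc n) = l1 / (p * w)" "P n 0 = p * w"
      by (simp_all add: \<rho>_def l0_def l1_def p_def w_def P0 x_def)
    have AL: "A L n = (4 * X - 1) * (((4 * X + 1) * l1 - X * R * l0) / (X * \<Delta>)) - Y * l0"
      unfolding A_def slope_def Let_def X_def R_def Y_def \<Delta>_def D_def l0_def l1_def x_def ..
    show ?thesis
      unfolding AL r x_def[symmetric] w_def[symmetric] R_def[symmetric] Y_def[symmetric] \<Delta>_def[symmetric]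
      unfolding X_def[symmetric]
      using nz by (simp add: divide_simps) (simp add: algebra_simps eval_nat_numeral)
  qed
  ultimately show "(\<lambda>n. A L n * of_nat (Suc n)^2 / P n 0) \<longlonglongrightarrow> 0" by simp
qed

section \<open>Summation over both indices\<close>

lemma summable_inverse_squares: "summable (\<lambda>k. 1 / real (Suc k) ^ 2)"
proof (rule summable_comparison_test)
  have "(\<lambda>k. 1 / real (Suc k)) \<longlonglongrightarrow> 0" using LIMSEQ_Suc[OF lim_1_over_n] by simp
  from telescope_summable'[OF this]
  show "summable (\<lambda>k. 2 * (1 / real (Suc k) - 1 / real (Suc (Suc k))))"
    by (rule summable_mult)
  \<comment> \<open>Because x + 1 <= 2x, twice a telescoping term dominates.\<close>
  have "1 / x ^ 2 \<le> 2 * (1 / x - 1 / (x + 1))" if "x \<ge> 1" for x :: real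
  proof -
    have "1 / x ^ 2 = 2 / (x * (x + x))" by (simp add: power2_eq_square)
    also have "\<dots> \<le> 2 / (x * (x + 1))"
      using that by (intro divide_left_mono mult_left_mono mult_pos_pos) auto
    also have "\<dots> = 2 * (1 / x - 1 / (x + 1))"
      using that by (subst diff_frac_eq) auto
    finally show ?thesis .
  qed
  from this[of "real (Suc k)" for k]
  show "\<exists>N. \<forall>k\<ge>N. norm (1 / real (Suc k) ^ 2) \<le> 2 * (1 / real (Suc k) - 1 / real (Suc (Suc k)))"
    by (auto simp: add_ac)
qed

definition majorant :: "nat \<Rightarrow> real" where
  "majorant n = (norm (A L n) + norm (B B0 n) + norm (C L n)) * real (Suc n) ^ 2 / (\<kappa> / norm (W 1) * norm (P n 0))"

lemma norm_F_le: "norm (F n k) \<le> majorant n * (1 / real (Suc k) ^ 2)"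
  unfolding F_def majorant_def Let_def by (rule norm_quadratic_over_P_le)

lemma summable_F: "summable (F n)"
  by (rule summable_comparison_test'[OF summable_mult[OF summable_inverse_squares] norm_F_le])

lemma suminf_F_tendsto_0: "(\<lambda>n. suminf (F n)) \<longlonglongrightarrow> 0"
proof -
  define S where "S = (\<Sum>k. 1 / real (Suc k) ^ 2)"
  have "(\<lambda>n. (norm (A L n * of_nat (Suc n)^2 / P n 0) + norm (B B0 n * of_nat (Suc n)^2 / P n 0)
      + norm (C L n * of_nat (Suc n)^2 / P n 0)) / (\<kappa> / norm (W 1))) \<longlonglongrightarrow> (0 + 0 + 0) / (\<kappa> / norm (W 1))"
    using \<kappa>_pos W_nonzero[of 1]
    by (intro tendsto_intros tendsto_norm_zero coefficients_decay) auto
  then have "majorant \<longlonglongrightarrow> 0"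
    by (simp add: majorant_def[abs_def] norm_mult norm_divide norm_power add_divide_distrib ring_distribs mult_ac del: of_nat_Suc)
  then show ?thesis
  proof (rule tendsto_0_le, intro always_eventually allI)
    fix n
    have "norm (suminf (F n)) \<le> (\<Sum>k. majorant n * (1 / real (Suc k) ^ 2))"
      by (intro norm_suminf_le norm_F_le summable_mult summable_inverse_squares)
    also have "\<dots> = majorant n * S"
      unfolding S_def by (rule suminf_mult[OF summable_inverse_squares])
    also have "\<dots> \<le> norm (majorant n) * S"
      by (intro mult_right_mono) (auto simp: S_def intro!: suminf_nonneg summable_inverse_squares simp del: of_nat_Suc)
    finally show "norm (suminf (F n)) \<le> norm (majorant n) * S" .
  qed
qed

lemma G_tendsto_0: "G n \<longlonglongrightarrow> 0"
proof -
  define r where "r = (5 * of_nat (Suc n)^2 / 2 - (a^2 + b^2) - 2 * of_nat (Suc n) + 1/2) / 2 * \<tau> B0 n"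
  \<comment> \<open>Even and odd parts of V_n are merged into one cubic in z, which loses against
    the quartic growth of P n k.\<close>
  have "(\<lambda>k. let z = of_nat k + 1 + of_nat n / 2 in
     ((A L n / 2 + r) + (slope L n + B B0 n / 2) * z + (C L n / 2 + \<tau> B0 n) * z^2 + L n * z^3) / P n k) \<longlonglongrightarrow> 0"
    unfolding Let_def by (rule cubic_over_P_tendsto_0)
  also have "(\<lambda>k. let z = of_nat k + 1 + of_nat n / 2 in
     ((A L n / 2 + r) + (slope L n + B B0 n / 2) * z + (C L n / 2 + \<tau> B0 n) * z^2 + L n * z^3) / P n k) = G n"
    unfolding G_def Let_def r_def[symmetric] by (intro ext arg_cong2[where f = "(/)"]) (simp_all add: field_simps)
  finally show ?thesis .
qed

lemma F_0: "F 0 k = (A0 + B0 * of_nat (Suc k) + C0 * of_nat (Suc k)^2)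
    / ((of_nat (Suc k)^2 - a^2) * (of_nat (Suc k)^2 - b^2))"
  by (simp add: F_def Let_def A_0 B_0 C_0 P_def quartic_def add_ac)

end

theorem theorem1:
  fixes a b A0 B0 C0 :: complex and L :: "nat \<Rightarrow> complex"
  assumes a: "norm a < 1" and b: "norm b < 1"
    and L_0: "L 0 = C0"
    and L_1: "L 1 = (1/3 - 2/15 * (a^2 + b^2)) * A0
      + (1/6 * (a^2 + b^2) - 2/15 * (a^4 + b^4 - 4 * a^2 * b^2) - 1/30) * C0"
    and L_rec: "\<And>n. n \<ge> 1 \<Longrightarrow>
      4 * (4 * of_nat n + 3) * (4 * of_nat n + 5) * (5 * of_nat n^2 - 2 * a^2 - 2 * b^2) * L (n + 1)
      + 2 * (of_nat n + 1) * p_poly a b (of_nat n) * L n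
      - of_nat n * (of_nat n + 1) * (5 * (of_nat n + 1)^2 - 2 * a^2 - 2 * b^2)
          * q_poly a b (of_nat n) * L (n - 1) = 0"
  defines "s \<equiv> \<lambda>k::nat. (A0 + B0 * of_nat k + C0 * of_nat k^2)
                  / ((of_nat k^2 - a^2) * (of_nat k^2 - b^2))"
    and "t \<equiv> \<lambda>n::nat. d_coeff a b B0 L n
                  / (\<Prod>m = 1..n. (of_nat m^2 - a^2) * (of_nat m^2 - b^2))"
  shows "summable (\<lambda>k. s (Suc k)) \<and> summable (\<lambda>n. t (Suc n))
    \<and> (\<Sum>k. s (Suc k)) = (\<Sum>n. t (Suc n))"
proof -
  interpret accelerated_series a b A0 B0 C0 L
    by unfold_locales (use a b L_0 L_1 L_rec in auto)
  have "F 0 = (\<lambda>k. s (Suc k))" by (simp only: s_def F_0 fun_eq_iff) simp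
  moreover have "(\<lambda>n. G n 0) = (\<lambda>n. t (Suc n))" by (simp only: t_def G_0)
  ultimately have "(\<lambda>n. t (Suc n)) sums (\<Sum>k. s (Suc k))" "summable (\<lambda>k. s (Suc k))"
    using sums_telescoping_pair[OF summable_F F_diff G_tendsto_0 suminf_F_tendsto_0] summable_F[of 0] by simp_all
  then show ?thesis by (simp add: sums_iff)
qed

end
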